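(* Let $n\ge 2$ and $d\ge 2$ be integers and let $q=2^d$. If $n$ is even, then $$\frac{\mu(n,d)}{\nu(n,d)}\le\prod_{j=1}^{\infty}\frac{1}{1-q^{1-2j}}\le e^{\frac{q+1}{q(q-1)}},$$ and if $n$ is odd, then $$\frac{\mu(n,d)}{\nu(n,d)}\le 2\prod_{j=1}^{\infty}\frac{1}{1-q^{1-2j}}\le 2\,e^{\frac{q+1}{q(q-1)}}.$$
   Context: For integers $n\ge 2$, $d\ge 1$ and $q=2^d$, define $$\mu(n,d)=q^{\binom n2}-1-\sum_{r=1}^{n-2}\binom nr (q-1)^{\binom{n-r}{2}}$$ (an empty sum is $0$) and $$\nu(n,d)=\begin{cases} q^{\binom n2}\displaystyle\prod_{j=1}^{\lceil (n-1)/2\rceil}\left(1-q^{1-2j}\right) & \text{if } n \text{ is even},\\[2mm] \left(q^{n-1}-2^{n-1}\right)q^{\binom{n-1}{2}}\displaystyle\prod_{j=1}^{\lceil (n-2)/2\rceil}\left(1-q^{1-2j}\right) & \text{if } n \text{ is odd}.\end{cases}$$ *)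

theory Defs
  imports "HOL-Analysis.Infinite_Products"
begin

definition mu :: "nat \<Rightarrow> nat \<Rightarrow> real" where
  "mu n d = (let q = (2::real) ^ d in
     q ^ (n choose 2) - 1 - (\<Sum>r=1..n-2. real (n choose r) * (q - 1) ^ ((n - r) choose 2)))"

definition nu :: "nat \<Rightarrow> nat \<Rightarrow> real" where
  "nu n d = (let q = (2::real) ^ d in
     if even n
     then q ^ (n choose 2) *
            (\<Prod>j=1..nat \<lceil>(real n - 1) / 2\<rceil>. 1 - q powi (1 - 2 * int j))
     else (q ^ (n - 1) - 2 ^ (n - 1)) * q ^ ((n - 1) choose 2) *
            (\<Prod>j=1..nat \<lceil>(real n - 2) / 2\<rceil>. 1 - q powi (1 - 2 * int j)))"

text \<open>The factors of the infinite product over \<open>j \<ge> 1\<close>. Infinite products in the library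
  are indexed from \<open>0\<close>, so the product over \<open>j \<ge> 1\<close> is that of
  \<open>\<lambda>j. euler_factor q (Suc j)\<close>.\<close>

definition euler_factor :: "real \<Rightarrow> nat \<Rightarrow> real" where
  "euler_factor q j = 1 / (1 - q powi (1 - 2 * int j))"

end

theory Submission
  imports Defs
begin

text \<open>
  Dropping the subtracted terms gives \<open>\<mu>(n,d) \<le> q ^ (n choose 2)\<close>, so \<open>\<mu> / \<nu>\<close> is at most a
  partial product of the Euler factors, times \<open>q ^ (n-1) / (q ^ (n-1) - 2 ^ (n-1)) \<le> 2\<close> when \<open>n\<close> is
  odd. All Euler factors \<open>1 + 1 / (q ^ (2j-1) - 1)\<close> exceed \<open>1\<close>, so partial products are bounded by
  the infinite product. The exponential bound follows from \<open>1 + x \<le> exp x\<close>: the first factor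
  contributes \<open>1 / (q - 1)\<close> to the exponent, and the \<open>j\<close>-th one at most \<open>q ^ (-j)\<close> for \<open>j \<ge> 2\<close>.
\<close>

text \<open>This form \<open>1 + a\<close> serves both the convergence criterion for products and
  the estimate \<open>1 + x <= exp x\<close>.\<close>

lemma euler_factor_Suc:
  assumes "q > 1"
  shows "euler_factor q (Suc k) = 1 + 1 / (q ^ (2 * k + 1) - 1)"
proof -
  have "1 - 2 * int (Suc k) = - int (2 * k + 1)"
    by simp
  then have "q powi (1 - 2 * int (Suc k)) = inverse (q ^ (2 * k + 1))"
    by (metis power_int_minus power_int_of_nat)
  moreover have "q ^ (2 * k + 1) > 1"
    using assms by (intro one_less_power) auto
  ultimately show ?thesis
    by (simp only: euler_factor_def) (auto simp: divide_simps)
qed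

lemma euler_factor_Suc_ge_1:
  assumes "q > 1"
  shows "euler_factor q (Suc k) \<ge> 1"
proof -
  have "q ^ (2 * k + 1) > 1"
    using assms by (intro one_less_power) auto
  then show ?thesis
    by (simp only: euler_factor_Suc[OF assms]) simp
qed

text \<open>Index \<open>k\<close> belongs to the factor \<open>j = k + 1\<close>. The case
  \<open>k = 0\<close> is kept apart because the excess \<open>1 / (q - 1)\<close> is larger than
  the geometric term \<open>1 / q\<close>.\<close>

definition exponent_bound :: "real \<Rightarrow> nat \<Rightarrow> real" where
  "exponent_bound q k = (if k = 0 then 1 / (q - 1) else (1 / q) ^ (k + 1))"

text \<open>The geometric tail from \<open>k = 1\<close> on sums to
  \<open>1 / (q * (q - 1))\<close>, and the head adds \<open>1 / (q - 1)\<close>.\<close>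

lemma exponent_bound_sums:
  assumes "q > 1"
  shows "exponent_bound q sums ((q + 1) / (q * (q - 1)))"
proof -
  have "(\<lambda>k. (1 / q) ^ 2 * (1 / q) ^ k) sums ((1 / q) ^ 2 * (1 / (1 - 1 / q)))"
    using assms by (intro sums_mult geometric_sums) auto
  then have "(\<lambda>k. exponent_bound q (Suc k)) sums ((1 / q) ^ 2 * (1 / (1 - 1 / q)))"
    by (simp add: exponent_bound_def power2_eq_square mult.assoc)
  then have "exponent_bound q sums ((1 / q) ^ 2 * (1 / (1 - 1 / q)) + exponent_bound q 0)"
    by (rule sums_Suc)
  moreover have "(1 / q) ^ 2 * (1 / (1 - 1 / q)) + exponent_bound q 0 = (q + 1) / (q * (q - 1))"
    using assms by (simp add: exponent_bound_def divide_simps power2_eq_square)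
  ultimately show ?thesis
    by simp
qed

text \<open>Equality holds at \<open>k = 0\<close>. For \<open>k > 0\<close>, the factor
  \<open>q ^ k >= 2\<close> yields two copies of \<open>q ^ (k + 1)\<close> inside
  \<open>q ^ (2 * k + 1)\<close>, and one of them absorbs the \<open>- 1\<close>.\<close>

lemma euler_factor_excess_le:
  assumes "q \<ge> 2"
  shows "1 / (q ^ (2 * k + 1) - 1) \<le> exponent_bound q k"
proof (cases k)
  case 0
  then show ?thesis
    by (simp add: exponent_bound_def)
next
  case (Suc m)
  have "q ^ k \<ge> q ^ 1"
    using assms Suc by (intro power_increasing) auto
  then have k: "q ^ k \<ge> 2"
    using assms by simp
  have k1: "q ^ (k + 1) \<ge> 1"
    using assms by (intro one_le_power) auto
  have "q ^ (k + 1) * 2 \<le> q ^ (k + 1) * q ^ k"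
    using k k1 by (intro mult_left_mono) auto
  also have "\<dots> = q ^ (2 * k + 1)"
    by (simp flip: power_add add: mult_2)
  finally have "q ^ (k + 1) \<le> q ^ (2 * k + 1) - 1"
    using k1 by linarith
  then have "1 / (q ^ (2 * k + 1) - 1) \<le> 1 / q ^ (k + 1)"
    using k1 by (intro divide_left_mono mult_pos_pos) auto
  then show ?thesis
    using Suc by (simp add: exponent_bound_def power_divide)
qed

text \<open>For positive excesses the product converges iff their sum does, and
  \<open>exponent_bound\<close> is a summable majorant.\<close>

lemma convergent_prod_euler_factor:
  assumes "q \<ge> 2"
  shows "convergent_prod (\<lambda>j. euler_factor q (Suc j))"
proof -
  have pos: "1 / (q ^ (2 * k + 1) - 1) > 0" for k
    using assms one_less_power[of q "2 * k + 1"] by simp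
  have "summable (\<lambda>k. 1 / (q ^ (2 * k + 1) - 1))"
  proof (rule summable_comparison_test')
    show "summable (exponent_bound q)"
      using exponent_bound_sums[of q] assms by (simp add: sums_iff)
    show "norm (1 / (q ^ (2 * k + 1) - 1)) \<le> exponent_bound q k" for k
      using euler_factor_excess_le[OF assms, of k] pos[of k] by (simp only: real_norm_def abs_of_pos)
  qed
  then have "convergent_prod (\<lambda>k. 1 + 1 / (q ^ (2 * k + 1) - 1))"
    using pos by (subst convergent_prod_iff_summable_real)
  then show ?thesis
    using assms by (subst euler_factor_Suc) auto
qed

lemma prodinf_euler_factor_le:
  assumes "q \<ge> 2"
  shows "(\<Prod>j. euler_factor q (Suc j)) \<le> exp ((q + 1) / (q * (q - 1)))"
proof (rule prodinf_le_const[OF convergent_prod_euler_factor[OF assms]])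
  fix n :: nat
  have q: "q > 1"
    using assms by simp
  have factor: "euler_factor q (Suc k) \<le> exp (exponent_bound q k)" for k
    using euler_factor_excess_le[OF assms, of k] exp_ge_add_one_self[of "exponent_bound q k"]
    unfolding euler_factor_Suc[OF q] by linarith
  have "(\<Prod>k<n. euler_factor q (Suc k)) \<le> (\<Prod>k<n. exp (exponent_bound q k))"
    using factor euler_factor_Suc_ge_1[OF q] by (intro prod_mono) (auto intro: order_trans[of 0 1])
  also have "\<dots> = exp (\<Sum>k<n. exponent_bound q k)"
    by (simp add: exp_sum)
  also have "(\<Sum>k<n. exponent_bound q k) \<le> suminf (exponent_bound q)"
    using exponent_bound_sums[OF q] q
    by (intro sum_le_suminf) (simp_all add: sums_iff, simp add: exponent_bound_def)
  also have "\<dots> = (q + 1) / (q * (q - 1))"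
    using exponent_bound_sums[OF q] by (simp add: sums_iff)
  finally show "(\<Prod>k<n. euler_factor q (Suc k)) \<le> exp ((q + 1) / (q * (q - 1)))"
    by simp
qed

text \<open>The bound is uniform in \<open>m\<close>, so the ceilings in \<open>nu\<close> need no
  evaluation. It is applied with \<open>c = 1\<close> for even \<open>n\<close> and
  \<open>c = 2\<close> for odd \<open>n\<close>.\<close>

lemma divide_prod_euler_le:
  assumes "q \<ge> 2" and "c \<ge> 0"
  shows "c / (\<Prod>j=1..m. 1 - q powi (1 - 2 * int j)) \<le> c * (\<Prod>j. euler_factor q (Suc j))"
proof -
  have q: "q > 1"
    using assms by simp
  have "c / (\<Prod>j=1..m. 1 - q powi (1 - 2 * int j)) = c * (\<Prod>j=1..m. euler_factor q j)"
    by (simp add: euler_factor_def prod_dividef)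
  also have "(\<Prod>j=1..m. euler_factor q j) = (\<Prod>j<m. euler_factor q (Suc j))"
    by (simp add: prod.atLeast1_atMost_eq)
  also have "c * \<dots> \<le> c * (\<Prod>j. euler_factor q (Suc j))"
  proof (rule mult_left_mono[OF prod_le_prodinf \<open>c \<ge> 0\<close>])
    show "(\<lambda>j. euler_factor q (Suc j)) has_prod (\<Prod>j. euler_factor q (Suc j))"
      using convergent_prod_euler_factor[OF assms(1)] by (rule convergent_prod_has_prod)
  qed (use euler_factor_Suc_ge_1[OF q] in \<open>auto intro: order_trans[of 0 1]\<close>)
  finally show ?thesis .
qed

text \<open>Supplies the sign of the denominators when numerators are compared.\<close>

lemma prod_euler_nonneg:
  fixes q :: real
  assumes "q > 1"
  shows "(\<Prod>j=1..m. 1 - q powi (1 - 2 * int j)) \<ge> 0"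
proof (rule prod_nonneg)
  fix j assume "j \<in> {1..m}"
  then have "q powi (1 - 2 * int j) \<le> 1"
    using assms power_int_increasing[of "1 - 2 * int j" 0 q] by simp
  then show "0 \<le> 1 - q powi (1 - 2 * int j)"
    by simp
qed

lemma mu_le:
  assumes "d \<ge> 1" and "q = 2 ^ d"
  shows "mu n d \<le> q ^ (n choose 2)"
proof -
  have "(\<Sum>r=1..n-2. real (n choose r) * (q - 1) ^ ((n - r) choose 2)) \<ge> 0"
    using assms by (intro sum_nonneg) auto
  then show ?thesis
    unfolding mu_def Let_def assms(2)[symmetric] by linarith
qed

theorem proposition3p6:
  fixes n d :: nat and q :: real
  assumes "n \<ge> 2" and "d \<ge> 2" and "q = 2 ^ d"
  shows "convergent_prod (\<lambda>j. euler_factor q (Suc j))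
    \<and> (even n \<longrightarrow>
         mu n d / nu n d \<le> (\<Prod>j. euler_factor q (Suc j))
         \<and> (\<Prod>j. euler_factor q (Suc j)) \<le> exp ((q + 1) / (q * (q - 1))))
    \<and> (odd n \<longrightarrow>
         mu n d / nu n d \<le> 2 * (\<Prod>j. euler_factor q (Suc j))
         \<and> 2 * (\<Prod>j. euler_factor q (Suc j)) \<le> 2 * exp ((q + 1) / (q * (q - 1))))"
proof -
  let ?P = "\<Prod>j. euler_factor q (Suc j)"
  let ?R = "\<lambda>m. \<Prod>j=1..m. 1 - q powi (1 - 2 * int j)"
  have "(2::real) ^ 2 \<le> 2 ^ d"
    using assms(2) by (intro power_increasing) auto
  then have q: "q \<ge> 4"
    using assms(3) by simp
  have mu: "mu n d \<le> q ^ (n choose 2)"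
    using assms by (intro mu_le) auto
  have even: "mu n d / nu n d \<le> ?P" if "even n"
  proof -
    let ?m = "nat \<lceil>(real n - 1) / 2\<rceil>"
    have nu: "nu n d = q ^ (n choose 2) * ?R ?m"
      using that by (simp only: nu_def Let_def assms(3) if_True)
    have "mu n d / nu n d \<le> q ^ (n choose 2) / nu n d"
      unfolding nu using mu q by (intro divide_right_mono mult_nonneg_nonneg prod_euler_nonneg) auto
    also have "\<dots> = 1 / ?R ?m"
      unfolding nu using q by simp
    also have "\<dots> \<le> 1 * ?P"
      using q by (intro divide_prod_euler_le) auto
    finally show ?thesis
      by simp
  qed
  have odd: "mu n d / nu n d \<le> 2 * ?P" if "odd n"
  proof -
    let ?m = "nat \<lceil>(real n - 2) / 2\<rceil>"
    let ?D = "q ^ (n - 1) - 2 ^ (n - 1)"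
    obtain k where k: "n = Suc k"
      using assms(1) by (cases n) auto
    \<comment> \<open>Pascal's rule: the power with exponent \<open>(n - 1) choose 2\<close> then
      cancels against \<open>nu\<close>, leaving \<open>q ^ (n - 1) / ?D\<close>.\<close>
    have choose: "n choose 2 = (n - 1) + ((n - 1) choose 2)"
      by (simp add: k numeral_2_eq_2)
    have nu: "nu n d = ?D * q ^ ((n - 1) choose 2) * ?R ?m"
      using that by (simp only: nu_def Let_def assms(3) if_False)
    \<comment> \<open>Here \<open>d >= 2\<close> enters through \<open>q >= 4\<close>: the
      subtracted \<open>2 ^ (n - 1)\<close> is at most half of \<open>q ^ (n - 1)\<close>, which is
      the source of the factor 2.\<close>
    have "2 * 2 ^ (n - 1) = (2::real) ^ n"
      by (simp add: k)
    also have "\<dots> \<le> 2 ^ (2 * (n - 1))"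
      using assms(1) by (intro power_increasing) auto
    also have "\<dots> = 4 ^ (n - 1)"
      by (simp add: power_mult)
    also have "\<dots> \<le> q ^ (n - 1)"
      using q by (intro power_mono) auto
    finally have le: "2 * 2 ^ (n - 1) \<le> q ^ (n - 1)" .
    have "(2::real) ^ (n - 1) > 0"
      by simp
    then have "?D > 0"
      using le by linarith
    moreover have "q ^ (n - 1) \<le> 2 * ?D"
      using le by (simp add: algebra_simps)
    ultimately have D: "?D > 0" "q ^ (n - 1) \<le> 2 * ?D"
      by auto
    have "mu n d / nu n d \<le> q ^ (n choose 2) / nu n d"
      unfolding nu using mu q D
      by (intro divide_right_mono mult_nonneg_nonneg prod_euler_nonneg) auto
    also have "\<dots> = (q ^ (n - 1) / ?D) / ?R ?m"
      unfolding nu choose power_add using q by simp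
    also have "\<dots> \<le> 2 / ?R ?m"
      using D q by (intro divide_right_mono prod_euler_nonneg) (auto simp: divide_simps)
    also have "\<dots> \<le> 2 * ?P"
      using q by (intro divide_prod_euler_le) auto
    finally show ?thesis .
  qed
  show ?thesis
    using even odd convergent_prod_euler_factor[of q] prodinf_euler_factor_le[of q] q by auto
qed

end
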